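(* For any $p\ge 1$, there exists some $c_p>0$ (depending only on $p$) such that the following holds for every integer $n\ge 2$. (i) For any $p>1$ and any $M_p>0$ with $n^{-1/p}(\log n)^{10}\le M_p^{1/p}\le n^2(\log n)^2$, $$\mathsf{Regret}_n\big(\mathcal{G}_p(M_p)\big)\ \ge\ c_p\,n^{-2(p-1)/(2p+1)}M_p^{3/(2p+1)}(\log n)^{-11}.$$ (ii) For $p=1$ and any $M_1>0$, $$\mathsf{Regret}_n\big(\mathcal{G}_1(M_1)\big)\ \ge\ c_1M_1 .$$
   Context: $\mathbb{R}_+=[0,\infty)$, $\mathbb{Z}_+=\{0,1,2,\ldots\}$. $\mathcal{P}(\mathbb{R}_+)$ is the set of Borel probability measures on $\mathbb{R}_+$; $m_p(G)=\int u^p\,G(du)$ and $\mathcal{G}_p(M_p)=\{G\in\mathcal{P}(\mathbb{R}_+): m_p(G)\le M_p\}$. Poisson empirical Bayes model with prior $G$: $\theta_1,\ldots,\theta_n$ are i.i.d. from $G$ and, conditionally on them, $Y_1,\ldots,Y_n$ are independent with $Y_i\sim\mathrm{Poi}(\theta_i)$; $\mathbb{E}_G$ is expectation in this model and $Y^n=(Y_1,\ldots,Y_n)$. The Bayes risk is $\mathsf{mmse}(G)=\inf_{h}\mathbb{E}_G(h(Y)-\theta)^2$, where $\theta\sim G$, $Y\mid\theta\sim\mathrm{Poi}(\theta)$ and the infimum is over all measurable functions $h$ of $Y$. The minimax individual regret over a class $\mathcal{G}$ of priors is $$\mathsf{Regret}_n(\mathcal{G})=\inf_{\hat\theta_n}\sup_{G\in\mathcal{G}}\Big\{\mathbb{E}_G\big(\hat\theta_n(Y^n)-\theta_n\big)^2-\mathsf{mmse}(G)\Big\},$$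 the infimum being over estimators $\hat\theta_n:\mathbb{Z}_+^n\to\mathbb{R}_+$ (of $\theta_n$). *)

theory Defs
  imports "HOL-Probability.Probability"
begin

definition nonneg_borel :: "real measure" where
  "nonneg_borel = restrict_space borel {0..}"

definition priors :: "real measure set" where
  "priors = {G. prob_space G \<and> sets G = sets nonneg_borel}"

definition moment :: "real \<Rightarrow> real measure \<Rightarrow> ennreal" where
  "moment p G = (\<integral>\<^sup>+ u. ennreal (u powr p) \<partial>G)"

definition moment_class :: "real \<Rightarrow> real \<Rightarrow> real measure set" where
  "moment_class p M = {G \<in> priors. moment p G \<le> ennreal M}"

(* The constant poisson_pmf is specified only for a positive rate; Poi(0) is the point mass at 0. *)
definition poi :: "real \<Rightarrow> nat pmf" where
  "poi \<theta> = (if \<theta> = 0 then return_pmf 0 else poisson_pmf \<theta>)"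

(* The law of (X, Y) on the product of M and N when X ~ M and Y | X = x ~ K x. *)
definition joint_law :: "'a measure \<Rightarrow> 'b measure \<Rightarrow> ('a \<Rightarrow> 'b measure) \<Rightarrow> ('a \<times> 'b) measure" where
  "joint_law M N K = M \<bind> (\<lambda>x. distr (K x) (M \<Otimes>\<^sub>M N) (Pair x))"

definition poisson_mixture :: "real measure \<Rightarrow> (real \<times> nat) measure" where
  "poisson_mixture G = joint_law G (count_space UNIV) (\<lambda>\<theta>. measure_pmf (poi \<theta>))"

definition eb_model :: "nat \<Rightarrow> real measure \<Rightarrow> ((nat \<Rightarrow> real) \<times> (nat \<Rightarrow> nat)) measure" where
  "eb_model n G =
     joint_law (\<Pi>\<^sub>M i\<in>{1..n}. G) (\<Pi>\<^sub>M i\<in>{1..n}. count_space UNIV)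
       (\<lambda>\<theta>. \<Pi>\<^sub>M i\<in>{1..n}. measure_pmf (poi (\<theta> i)))"

definition mmse :: "real measure \<Rightarrow> ennreal" where
  "mmse G = (INF h \<in> count_space UNIV \<rightarrow>\<^sub>M borel.
     \<integral>\<^sup>+ (\<theta>, y). ennreal ((h y - \<theta>)\<^sup>2) \<partial>poisson_mixture G)"

(* Every function on the countable space of observations is measurable. *)
definition estimators :: "nat \<Rightarrow> ((nat \<Rightarrow> nat) \<Rightarrow> real) set" where
  "estimators n = ({1..n} \<rightarrow>\<^sub>E UNIV) \<rightarrow> {0..}"

definition risk :: "nat \<Rightarrow> real measure \<Rightarrow> ((nat \<Rightarrow> nat) \<Rightarrow> real) \<Rightarrow> ennreal" where
  "risk n G t = (\<integral>\<^sup>+ (\<theta>, y). ennreal ((t y - \<theta> n)\<^sup>2) \<partial>eb_model n G)"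

(* The risk may be infinite, but mmse G is at most the mean of G (take h y = y), so the
   difference is never of the form infinity - infinity on classes of priors with finite mean. *)
definition regret :: "nat \<Rightarrow> real measure set \<Rightarrow> ereal" where
  "regret n \<G> = (INF t \<in> estimators n. SUP G \<in> \<G>. enn2ereal (risk n G t) - enn2ereal (mmse G))"

text \<open>The kernels are measurable, so both models are probability measures (the bind of a
  non-measurable kernel would be meaningless), and expectations can be computed by conditioning.\<close>

lemma borel_measurable_pmf_poi: "(\<lambda>\<theta>. pmf (poi \<theta>) k) \<in> borel_measurable nonneg_borel"
proof -
  have "(\<lambda>\<theta>::real. if \<theta> = 0 then (if k = 0 then 1 else 0) else \<theta> ^ k / fact k * exp (- \<theta>))
          \<in> borel_measurable nonneg_borel"
    unfolding nonneg_borel_def by (intro measurable_restrict_space1) measurable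
  then show ?thesis
    by (rule measurable_cong[THEN iffD1, rotated])
       (auto simp: poi_def nonneg_borel_def space_restrict_space pmf_return)
qed

lemma borel_measurable_emeasure_poi:
  "(\<lambda>\<theta>. emeasure (measure_pmf (poi \<theta>)) A) \<in> borel_measurable nonneg_borel"
proof -
  have "emeasure (measure_pmf (poi \<theta>)) A = (\<Sum>k. ennreal (pmf (poi \<theta>) k) * indicator A k)" for \<theta>
    by (subst nn_integral_indicator[symmetric])
       (simp_all add: nn_integral_measure_pmf nn_integral_count_space_nat)
  then show ?thesis
    using borel_measurable_pmf_poi by simp
qed

lemma measurable_poi:
  assumes "sets G = sets nonneg_borel"
  shows "(\<lambda>\<theta>. measure_pmf (poi \<theta>)) \<in> G \<rightarrow>\<^sub>M prob_algebra (count_space UNIV)"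
  unfolding measurable_cong_sets[OF assms refl]
proof (rule measurable_prob_algebra_generated[where \<Omega> = UNIV and G = UNIV])
  show "sets (count_space UNIV) = sigma_sets UNIV (UNIV :: nat set set)"
    using sets.sigma_sets_eq[of "count_space (UNIV :: nat set)"] by simp
qed (simp_all add: Int_stable_def prob_space_measure_pmf borel_measurable_emeasure_poi)

lemma measurable_PiM_poi:
  assumes G: "sets G = sets nonneg_borel"
  shows "(\<lambda>\<theta>. \<Pi>\<^sub>M i\<in>{1..n::nat}. measure_pmf (poi (\<theta> i)))
    \<in> (\<Pi>\<^sub>M i\<in>{1..n}. G) \<rightarrow>\<^sub>M prob_algebra (\<Pi>\<^sub>M i\<in>{1..n}. count_space UNIV)"
proof (rule measurable_prob_algebra_generated[OF sets_PiM Int_stable_prod_algebra prod_algebra_sets_into_space])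
  fix \<theta> :: "nat \<Rightarrow> real"
  show "prob_space (\<Pi>\<^sub>M i\<in>{1..n}. measure_pmf (poi (\<theta> i)))"
    by (intro prob_space_PiM prob_space_measure_pmf)
  show "sets (\<Pi>\<^sub>M i\<in>{1..n}. measure_pmf (poi (\<theta> i))) = sets (\<Pi>\<^sub>M i\<in>{1..n}. count_space UNIV)"
    by (intro sets_PiM_cong) auto
next
  fix A :: "(nat \<Rightarrow> nat) set"
  assume "A \<in> prod_algebra {1..n} (\<lambda>i. count_space UNIV)"
  then obtain E where A: "A = Pi\<^sub>E {1..n} E"
    by (rule prod_algebraE_all) auto
  have "emeasure (\<Pi>\<^sub>M i\<in>{1..n}. measure_pmf (poi (\<theta> i))) A
      = (\<Prod>i\<in>{1..n}. emeasure (measure_pmf (poi (\<theta> i))) (E i))" for \<theta>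
  proof -
    interpret product_prob_space "\<lambda>i. measure_pmf (poi (\<theta> i))" "{1..n}"
      by standard
    show ?thesis unfolding A by (subst emeasure_PiM) auto
  qed
  moreover have "(\<lambda>\<theta>. emeasure (measure_pmf (poi (\<theta> i))) (E i)) \<in> borel_measurable (\<Pi>\<^sub>M i\<in>{1..n}. G)"
    if "i \<in> {1..n}" for i
    using measurable_compose[OF measurable_component_singleton[OF that, of "\<lambda>_. G"]]
      borel_measurable_emeasure_poi[of "E i"]
    by (simp add: measurable_cong_sets[OF G refl])
  ultimately show "(\<lambda>\<theta>. emeasure (\<Pi>\<^sub>M i\<in>{1..n}. measure_pmf (poi (\<theta> i))) A)
      \<in> borel_measurable (\<Pi>\<^sub>M i\<in>{1..n}. G)"
    by simp
qed

lemma measurable_joint_kernel: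
  assumes K: "K \<in> M \<rightarrow>\<^sub>M prob_algebra N"
  shows "(\<lambda>x. distr (K x) (M \<Otimes>\<^sub>M N) (Pair x)) \<in> M \<rightarrow>\<^sub>M prob_algebra (M \<Otimes>\<^sub>M N)"
  by (rule measurable_distr_prob_space2[OF K]) measurable

lemma prob_space_joint_law:
  assumes M: "prob_space M" and K: "K \<in> M \<rightarrow>\<^sub>M prob_algebra N"
  shows "prob_space (joint_law M N K)" "sets (joint_law M N K) = sets (M \<Otimes>\<^sub>M N)"
proof -
  have "M \<in> space (prob_algebra M)"
    using M by (simp add: space_prob_algebra)
  then show "prob_space (joint_law M N K)" "sets (joint_law M N K) = sets (M \<Otimes>\<^sub>M N)"
    unfolding joint_law_def
    by (rule prob_space_bind'[OF _ measurable_joint_kernel[OF K]],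
        rule sets_bind'[OF _ measurable_joint_kernel[OF K]])
qed

lemma nn_integral_joint_law:
  assumes K: "K \<in> M \<rightarrow>\<^sub>M prob_algebra N" and f: "f \<in> borel_measurable (M \<Otimes>\<^sub>M N)"
  shows "(\<integral>\<^sup>+ z. f z \<partial>joint_law M N K) = (\<integral>\<^sup>+ x. \<integral>\<^sup>+ y. f (x, y) \<partial>K x \<partial>M)"
proof -
  have "(\<integral>\<^sup>+ z. f z \<partial>joint_law M N K)
      = (\<integral>\<^sup>+ x. \<integral>\<^sup>+ z. f z \<partial>distr (K x) (M \<Otimes>\<^sub>M N) (Pair x) \<partial>M)"
    unfolding joint_law_def
    by (rule nn_integral_bind[OF f measurable_prob_algebraD[OF measurable_joint_kernel[OF K]]])
  also have "\<dots> = (\<integral>\<^sup>+ x. \<integral>\<^sup>+ y. f (x, y) \<partial>K x \<partial>M)"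
  proof (rule nn_integral_cong)
    fix x assume x: "x \<in> space M"
    then have "sets (K x) = sets N"
      using measurable_space[OF K x] by (simp add: space_prob_algebra)
    then have "Pair x \<in> K x \<rightarrow>\<^sub>M M \<Otimes>\<^sub>M N"
      unfolding measurable_cong_sets[OF \<open>sets (K x) = sets N\<close> refl] by (intro measurable_Pair1' x)
    then show "(\<integral>\<^sup>+ z. f z \<partial>distr (K x) (M \<Otimes>\<^sub>M N) (Pair x)) = (\<integral>\<^sup>+ y. f (x, y) \<partial>K x)"
      using f by (simp add: nn_integral_distr)
  qed
  finally show ?thesis .
qed

lemma prob_space_poisson_mixture: "G \<in> priors \<Longrightarrow> prob_space (poisson_mixture G)"
  unfolding poisson_mixture_def priors_def by (simp add: prob_space_joint_law(1) measurable_poi)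

lemma prob_space_eb_model:
  assumes "G \<in> priors"
  shows "prob_space (eb_model n G)"
proof -
  have G: "prob_space G" "sets G = sets nonneg_borel"
    using assms by (simp_all add: priors_def)
  show ?thesis
    unfolding eb_model_def
    by (rule prob_space_joint_law(1)[OF prob_space_PiM[OF G(1)] measurable_PiM_poi[OF G(2)]])
qed

end

theory Submission
  imports Defs
begin

text \<open>
  The hard priors put mass \<open>w\<close> of order at most \<open>1/n\<close> at each of \<open>N\<close> points of size \<open>R\<^sup>2\<close> and the rest
  at \<open>0\<close>. Each point has two possible locations at distance of order \<open>R\<close> (the Poisson standard deviation),
  while different points are a large multiple of \<open>R\<close> apart. An oracle who knows the locations picks
  the nearest one, and by the fourth central moment its risk is at most \<open>N w R\<^sup>2 / 48\<close>. Without that knowledge,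
  when \<open>\<theta>\<^sub>n\<close> is one of the nonzero points, with constant probability no other parameter is the
  same point. The other observations are then uninformative about its location, and a two-point bound,
  averaged over all choices of locations, shows that some prior forces risk \<open>N w R\<^sup>2 / 12\<close>.
  With \<open>N\<close> of order \<open>R\<close>, \<open>w\<close> of order \<open>1/n\<close> and \<open>R\<^sup>2\<^sup>p\<^sup>+\<^sup>1\<close> of order \<open>n M\<close> the regret is of order
  \<open>R\<^sup>3 / n\<close>, the claimed rate. For \<open>p = 1\<close> one point is enough, with \<open>w R\<^sup>2\<close> of order \<open>M\<close> and \<open>R\<close> large.
\<close>

subsection \<open>Priors with countable support\<close>

text \<open>A finite product measure is determined by its values on rectangles. The restriction
  translates between functions that are \<open>undefined\<close> off \<open>I\<close> and functions
  with default value \<open>d\<close> there.\<close>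

lemma PiM_measure_pmf_conv_Pi_pmf:
  assumes "finite I"
  shows "(\<Pi>\<^sub>M i\<in>I. measure_pmf (p i))
    = distr (measure_pmf (Pi_pmf I d p)) (\<Pi>\<^sub>M i\<in>I. count_space UNIV) (\<lambda>f. restrict f I)"
proof -
  interpret product_prob_space "\<lambda>i. measure_pmf (p i)" I
    by standard
  have sets: "sets (\<Pi>\<^sub>M i\<in>I. measure_pmf (p i)) = sets (\<Pi>\<^sub>M i\<in>I. count_space UNIV)"
    by (intro sets_PiM_cong) auto
  show ?thesis
  proof (rule PiM_eqI[symmetric])
    fix A :: "'a \<Rightarrow> 'b set"
    have "Pi\<^sub>E I A \<in> sets (\<Pi>\<^sub>M i\<in>I. count_space UNIV)"
      using assms by (intro sets_PiM_I_finite) auto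
    moreover have "(\<lambda>f. restrict f I) -` Pi\<^sub>E I A = Pi I A"
      by (auto simp: PiE_def Pi_def)
    ultimately show "emeasure (distr (measure_pmf (Pi_pmf I d p)) (\<Pi>\<^sub>M i\<in>I. count_space UNIV) (\<lambda>f. restrict f I)) (Pi\<^sub>E I A)
        = (\<Prod>i\<in>I. emeasure (measure_pmf (p i)) (A i))"
      using assms
      by (subst emeasure_distr)
         (auto simp: space_PiM measure_pmf.emeasure_eq_measure measure_Pi_pmf_Pi prod_ennreal)
  qed (use assms in \<open>simp_all add: sets\<close>)
qed

text \<open>For a countable type and a finite index set the product sigma-algebra is discrete, so
  every \<open>f\<close> is measurable.\<close>

lemma nn_integral_PiM_measure_pmf:
  fixes p :: "'i \<Rightarrow> 'a :: countable pmf"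
  assumes "finite I"
  shows "(\<integral>\<^sup>+ y. f y \<partial>(\<Pi>\<^sub>M i\<in>I. measure_pmf (p i))) = (\<integral>\<^sup>+ y. f (restrict y I) \<partial>Pi_pmf I d p)"
  unfolding PiM_measure_pmf_conv_Pi_pmf[OF assms, where d = d]
  using assms by (subst nn_integral_distr) (auto simp: space_PiM count_space_PiM_finite)

text \<open>A label is drawn from \<open>q\<close> and then placed by \<open>b\<close>, so priors
  with different locations share one law of labels.\<close>

definition discrete_prior :: "nat pmf \<Rightarrow> (nat \<Rightarrow> real) \<Rightarrow> real measure" where
  "discrete_prior q b = distr (measure_pmf q) nonneg_borel b"

lemma space_nonneg_borel [simp]: "space nonneg_borel = {0..}"
  by (simp add: nonneg_borel_def space_restrict_space)

lemma borel_measurable_nonneg_borel: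
  "f \<in> borel_measurable borel \<Longrightarrow> f \<in> borel_measurable nonneg_borel"
  unfolding nonneg_borel_def by (rule measurable_restrict_space1)

lemma sets_discrete_prior [simp]: "sets (discrete_prior q b) = sets nonneg_borel"
  by (simp add: discrete_prior_def)

lemma discrete_prior_in_priors:
  assumes "\<And>k. 0 \<le> b k"
  shows "discrete_prior q b \<in> priors"
  using assms by (auto simp: priors_def discrete_prior_def intro!: measure_pmf.prob_space_distr)

lemma nn_integral_discrete_prior:
  assumes "\<And>k. 0 \<le> b k" "f \<in> borel_measurable nonneg_borel"
  shows "(\<integral>\<^sup>+ u. f u \<partial>discrete_prior q b) = (\<integral>\<^sup>+ k. f (b k) \<partial>measure_pmf q)"
  unfolding discrete_prior_def using assms by (intro nn_integral_distr) auto

lemma nn_integral_poisson_mixture: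
  assumes "\<And>k. 0 \<le> b k"
  shows "(\<integral>\<^sup>+ (\<theta>, y). ennreal ((h y - \<theta>)\<^sup>2) \<partial>poisson_mixture (discrete_prior q b))
    = (\<integral>\<^sup>+ k. \<integral>\<^sup>+ y. ennreal ((h y - b k)\<^sup>2) \<partial>poi (b k) \<partial>measure_pmf q)"
proof -
  let ?G = "discrete_prior q b" and ?f = "\<lambda>(\<theta>, y). ennreal ((h y - \<theta>)\<^sup>2)"
  have K: "(\<lambda>\<theta>. measure_pmf (poi \<theta>)) \<in> ?G \<rightarrow>\<^sub>M prob_algebra (count_space UNIV)"
    by (rule measurable_poi) simp
  have id: "(\<lambda>u. u) \<in> borel_measurable ?G"
    unfolding measurable_cong_sets[OF sets_discrete_prior refl]
    by (intro borel_measurable_nonneg_borel) simp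
  have [measurable]: "fst \<in> borel_measurable (?G \<Otimes>\<^sub>M count_space UNIV)"
    by (rule measurable_compose[OF measurable_fst id])
  have [measurable]: "(\<lambda>z. h (snd z)) \<in> borel_measurable (?G \<Otimes>\<^sub>M count_space UNIV)"
    by (rule measurable_compose[OF measurable_snd]) simp
  have f: "?f \<in> borel_measurable (?G \<Otimes>\<^sub>M count_space UNIV)"
    unfolding split_beta' by measurable
  have "(\<integral>\<^sup>+ z. ?f z \<partial>poisson_mixture ?G)
      = (\<integral>\<^sup>+ \<theta>. \<integral>\<^sup>+ y. ?f (\<theta>, y) \<partial>poi \<theta> \<partial>?G)"
    unfolding poisson_mixture_def by (rule nn_integral_joint_law[OF K f])
  also have "\<dots> = (\<integral>\<^sup>+ k. \<integral>\<^sup>+ y. ?f (b k, y) \<partial>poi (b k) \<partial>measure_pmf q)"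
  proof (rule nn_integral_discrete_prior[OF assms])
    have [measurable]: "(\<lambda>\<theta>. pmf (poi \<theta>) y) \<in> borel_measurable nonneg_borel"
      "(\<lambda>u. u) \<in> borel_measurable nonneg_borel" for y
      by (rule borel_measurable_pmf_poi, rule borel_measurable_nonneg_borel) simp
    \<comment> \<open>The inner integral is a series over \<open>y\<close> whose terms are
      measurable in \<theta>.\<close>
    have "(\<lambda>\<theta>. \<Sum>y. ennreal (pmf (poi \<theta>) y) * ennreal ((h y - \<theta>)\<^sup>2)) \<in> borel_measurable nonneg_borel"
      by (intro borel_measurable_suminf_order borel_measurable_times measurable_compose[OF _ measurable_ennreal]
          borel_measurable_power borel_measurable_diff) simp_all
    then show "(\<lambda>\<theta>. \<integral>\<^sup>+ y. ?f (\<theta>, y) \<partial>poi \<theta>) \<in> borel_measurable nonneg_borel"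
      by (simp add: nn_integral_measure_pmf nn_integral_count_space_nat)
  qed
  finally show ?thesis by simp
qed

text \<open>The product of image measures is the image of the product measure, so the parameters
  arise from independent labels \<open>\<kappa>\<close>.\<close>

lemma risk_discrete_prior:
  assumes b: "\<And>k. 0 \<le> b k" and n: "n \<ge> 1"
  shows "risk n (discrete_prior q b) t
    = (\<integral>\<^sup>+ \<kappa>. \<integral>\<^sup>+ y. ennreal ((t (restrict y {1..n}) - b (\<kappa> n))\<^sup>2)
        \<partial>Pi_pmf {1..n} d (\<lambda>i. poi (b (\<kappa> i))) \<partial>Pi_pmf {1..n} d' (\<lambda>_. q))"
proof -
  let ?G = "discrete_prior q b" and ?I = "{1..n}"
  let ?N = "\<Pi>\<^sub>M i\<in>?I. (count_space UNIV :: nat measure)"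
  let ?K = "\<lambda>\<theta>. \<Pi>\<^sub>M i\<in>?I. measure_pmf (poi (\<theta> i))"
  have nI: "n \<in> ?I" using n by auto
  have K: "?K \<in> (\<Pi>\<^sub>M i\<in>?I. ?G) \<rightarrow>\<^sub>M prob_algebra ?N"
    by (rule measurable_PiM_poi) simp
  have N: "?N = count_space (?I \<rightarrow>\<^sub>E UNIV)"
    by (rule count_space_PiM_finite) auto
  have t: "t \<in> borel_measurable ?N"
    unfolding N by simp
  have id: "(\<lambda>u. u) \<in> borel_measurable ?G"
    unfolding measurable_cong_sets[OF sets_discrete_prior refl]
    by (intro borel_measurable_nonneg_borel) simp
  have comp: "(\<lambda>\<theta>. \<theta> n) \<in> borel_measurable (\<Pi>\<^sub>M i\<in>?I. ?G)"
    using measurable_compose[OF measurable_component_singleton[OF nI, of "\<lambda>_. ?G"] id] .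
  let ?f = "\<lambda>(\<theta>, y). ennreal ((t y - \<theta> n)\<^sup>2)"
  have [measurable]: "(\<lambda>z. fst z n) \<in> borel_measurable ((\<Pi>\<^sub>M i\<in>?I. ?G) \<Otimes>\<^sub>M ?N)"
    by (rule measurable_compose[OF measurable_fst comp])
  have [measurable]: "(\<lambda>z. t (snd z)) \<in> borel_measurable ((\<Pi>\<^sub>M i\<in>?I. ?G) \<Otimes>\<^sub>M ?N)"
    by (rule measurable_compose[OF measurable_snd t])
  have f: "?f \<in> borel_measurable ((\<Pi>\<^sub>M i\<in>?I. ?G) \<Otimes>\<^sub>M ?N)"
    unfolding split_beta' by measurable
  have r: "risk n ?G t = (\<integral>\<^sup>+ \<theta>. \<integral>\<^sup>+ y. ?f (\<theta>, y) \<partial>?K \<theta> \<partial>(\<Pi>\<^sub>M i\<in>?I. ?G))"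
    unfolding risk_def eb_model_def by (rule nn_integral_joint_law[OF K f])
  have bG[measurable]: "b \<in> measure_pmf q \<rightarrow>\<^sub>M ?G"
    unfolding measurable_cong_sets[OF refl sets_discrete_prior] using b by auto
  have G: "prob_space ?G"
    using discrete_prior_in_priors[OF b] by (simp add: priors_def)
  have PG: "(\<Pi>\<^sub>M i\<in>?I. ?G) = distr (\<Pi>\<^sub>M i\<in>?I. measure_pmf q) (\<Pi>\<^sub>M i\<in>?I. ?G) (compose ?I b)"
  proof -
    have "distr (\<Pi>\<^sub>M i\<in>?I. measure_pmf q) (\<Pi>\<^sub>M i\<in>?I. ?G) (compose ?I b)
        = (\<Pi>\<^sub>M i\<in>?I. distr (measure_pmf q) ?G b)"
      by (intro distr_PiM_finite_prob_space' G bG measure_pmf.prob_space_axioms) simp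
    also have "distr (measure_pmf q) ?G b = ?G"
      unfolding discrete_prior_def by (rule distr_cong) auto
    finally show ?thesis ..
  qed
  have c: "compose ?I b \<in> (\<Pi>\<^sub>M i\<in>?I. measure_pmf q) \<rightarrow>\<^sub>M (\<Pi>\<^sub>M i\<in>?I. ?G)"
    unfolding compose_def by measurable
  let ?g = "\<lambda>\<theta>. \<integral>\<^sup>+ y. ?f (\<theta>, y) \<partial>?K \<theta>"
  have meas: "?g \<in> borel_measurable (\<Pi>\<^sub>M i\<in>?I. ?G)"
  proof (rule nn_integral_measurable_subprob_algebra2)
    show "(\<lambda>(\<theta>, y). ?f (\<theta>, y)) \<in> borel_measurable ((\<Pi>\<^sub>M i\<in>?I. ?G) \<Otimes>\<^sub>M ?N)"
      using f by (simp add: split_beta')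
  qed (rule measurable_prob_algebraD[OF K])
  have "risk n ?G t = (\<integral>\<^sup>+ \<theta>. ?g \<theta> \<partial>distr (\<Pi>\<^sub>M i\<in>?I. measure_pmf q) (\<Pi>\<^sub>M i\<in>?I. ?G) (compose ?I b))"
    unfolding r by (simp only: PG[symmetric])
  also have "\<dots> = (\<integral>\<^sup>+ \<kappa>. ?g (compose ?I b \<kappa>) \<partial>(\<Pi>\<^sub>M i\<in>?I. measure_pmf q))"
    by (rule nn_integral_distr[OF c]) (use meas in simp)
  also have "\<dots> = (\<integral>\<^sup>+ \<kappa>. ?g (compose ?I b (restrict \<kappa> ?I)) \<partial>Pi_pmf ?I d' (\<lambda>_. q))"
    by (rule nn_integral_PiM_measure_pmf) simp
  also have "\<dots> = (\<integral>\<^sup>+ \<kappa>. \<integral>\<^sup>+ y. ennreal ((t (restrict y ?I) - b (\<kappa> n))\<^sup>2)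
        \<partial>Pi_pmf ?I d (\<lambda>i. poi (b (\<kappa> i))) \<partial>Pi_pmf ?I d' (\<lambda>_. q))"
  proof (rule nn_integral_cong)
    fix \<kappa> :: "nat \<Rightarrow> nat"
    have "?K (compose ?I b (restrict \<kappa> ?I)) = (\<Pi>\<^sub>M i\<in>?I. measure_pmf (poi (b (\<kappa> i))))"
      by (intro PiM_cong) (auto simp: compose_def)
    then show "?g (compose ?I b (restrict \<kappa> ?I))
        = (\<integral>\<^sup>+ y. ennreal ((t (restrict y ?I) - b (\<kappa> n))\<^sup>2) \<partial>Pi_pmf ?I d (\<lambda>i. poi (b (\<kappa> i))))"
      using nI by (simp add: compose_def nn_integral_PiM_measure_pmf[where d = d])
  qed
  finally show ?thesis .
qed

subsection \<open>Poisson laws\<close>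

lemma nn_integral_pmf_nat_sums:
  fixes p :: "nat pmf"
  assumes "\<And>y. 0 \<le> f y" "(\<lambda>y. pmf p y * f y) sums s"
  shows "(\<integral>\<^sup>+ y. ennreal (f y) \<partial>p) = ennreal s"
  using assms
  by (simp add: nn_integral_measure_pmf nn_integral_count_space_nat ennreal_mult[symmetric]
      suminf_ennreal2 sums_iff)

lemma pmf_poi:
  assumes "0 \<le> \<theta>"
  shows "pmf (poi \<theta>) k = \<theta> ^ k / fact k * exp (- \<theta>)"
  using assms by (cases "k = 0") (auto simp: poi_def pmf_return)

text \<open>Terms with \<open>y < j\<close> vanish; shifting the index by \<open>j\<close> cancels
  the falling factorial and leaves the exponential series.\<close>

lemma poi_factorial_moment:
  assumes "0 \<le> \<theta>"
  shows "(\<lambda>y. pmf (poi \<theta>) y * (\<Prod>i<j. real y - real i)) sums \<theta> ^ j"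
proof -
  let ?f = "\<lambda>y. pmf (poi \<theta>) y * (\<Prod>i<j. real y - real i)"
  have z: "?f i = 0" if "i < j" for i
    using that by (auto intro!: prod_zero bexI[of _ i])
  have P: "(\<Prod>i<j. real (y + j) - real i) * fact y = fact (y + j)" for y
  proof (induction j)
    case (Suc j)
    have "(\<Prod>i<Suc j. real (y + Suc j) - real i)
        = real (y + Suc j) * (\<Prod>i<j. real (y + Suc j) - real (Suc i))"
      by (subst prod.lessThan_Suc_shift) simp
    also have "\<dots> = real (y + Suc j) * (\<Prod>i<j. real (y + j) - real i)"
      by simp
    finally have "(\<Prod>i<Suc j. real (y + Suc j) - real i) * fact y
        = real (y + Suc j) * ((\<Prod>i<j. real (y + j) - real i) * fact y)"
      by simp
    then show ?case unfolding Suc by simp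
  qed simp
  have "?f (y + j) = \<theta> ^ j * exp (- \<theta>) * (\<theta> ^ y /\<^sub>R fact y)" for y
  proof -
    have "(\<Prod>i<j. real (y + j) - real i) = fact (y + j) / fact y"
      using P[of y] by (simp add: field_simps)
    then show ?thesis
      using assms by (simp add: pmf_poi power_add field_simps)
  qed
  moreover have "(\<lambda>y. \<theta> ^ j * exp (- \<theta>) * (\<theta> ^ y /\<^sub>R fact y)) sums (\<theta> ^ j * exp (- \<theta>) * exp \<theta>)"
    by (intro sums_mult exp_converges)
  moreover have "\<theta> ^ j * exp (- \<theta>) * exp \<theta> = \<theta> ^ j"
    by (simp add: exp_minus)
  ultimately have "(\<lambda>y. ?f (y + j)) sums \<theta> ^ j"
    by simp
  then show ?thesis
    by (subst (asm) sums_zero_iff_shift) (use z in auto)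
qed

text \<open>Expand the fourth power in falling factorials, whose means are powers of \<theta>. The
  constant terms 1, 6, 7, 1 of the coefficients are the Stirling numbers for
  \<open>y ^ 4\<close>.\<close>

lemma poi_fourth_central_moment:
  assumes "0 \<le> \<theta>"
  shows "(\<integral>\<^sup>+ y. ennreal ((real y - \<theta>) ^ 4) \<partial>poi \<theta>) = ennreal (3 * \<theta>\<^sup>2 + \<theta>)"
proof (rule nn_integral_pmf_nat_sums)
  let ?m = "\<lambda>j y. pmf (poi \<theta>) y * (\<Prod>i<j. real y - real i)"
  have "(\<lambda>y. ?m 4 y + (6 - 4 * \<theta>) * ?m 3 y + (7 - 12 * \<theta> + 6 * \<theta>\<^sup>2) * ?m 2 y
      + (1 - 4 * \<theta> + 6 * \<theta>\<^sup>2 - 4 * \<theta> ^ 3) * ?m 1 y + \<theta> ^ 4 * ?m 0 y)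
    sums (\<theta> ^ 4 + (6 - 4 * \<theta>) * \<theta> ^ 3 + (7 - 12 * \<theta> + 6 * \<theta>\<^sup>2) * \<theta> ^ 2
      + (1 - 4 * \<theta> + 6 * \<theta>\<^sup>2 - 4 * \<theta> ^ 3) * \<theta> ^ 1 + \<theta> ^ 4 * \<theta> ^ 0)"
    by (intro sums_add sums_mult poi_factorial_moment assms)
  also have "(\<lambda>y. ?m 4 y + (6 - 4 * \<theta>) * ?m 3 y + (7 - 12 * \<theta> + 6 * \<theta>\<^sup>2) * ?m 2 y
      + (1 - 4 * \<theta> + 6 * \<theta>\<^sup>2 - 4 * \<theta> ^ 3) * ?m 1 y + \<theta> ^ 4 * ?m 0 y)
    = (\<lambda>y. pmf (poi \<theta>) y * (real y - \<theta>) ^ 4)"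
    by (rule ext) (simp add: eval_nat_numeral algebra_simps)
  also have "\<theta> ^ 4 + (6 - 4 * \<theta>) * \<theta> ^ 3 + (7 - 12 * \<theta> + 6 * \<theta>\<^sup>2) * \<theta> ^ 2
      + (1 - 4 * \<theta> + 6 * \<theta>\<^sup>2 - 4 * \<theta> ^ 3) * \<theta> ^ 1 + \<theta> ^ 4 * \<theta> ^ 0 = 3 * \<theta>\<^sup>2 + \<theta>"
    by (simp add: eval_nat_numeral algebra_simps)
  finally show "(\<lambda>y. pmf (poi \<theta>) y * (real y - \<theta>) ^ 4) sums (3 * \<theta>\<^sup>2 + \<theta>)" .
qed simp

text \<open>The Hellinger affinity of two Poisson laws. It depends only on the difference of the
  square roots of the rates; the summands form an exponential series in
  \<open>r * s\<close>.\<close>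

lemma poi_affinity_sums:
  assumes "0 \<le> r" "0 \<le> s"
  shows "(\<lambda>y. sqrt (pmf (poi (r\<^sup>2)) y * pmf (poi (s\<^sup>2)) y)) sums exp (- (r - s)\<^sup>2 / 2)"
proof -
  have "sqrt (pmf (poi (r\<^sup>2)) y * pmf (poi (s\<^sup>2)) y)
      = exp (- (r\<^sup>2 + s\<^sup>2) / 2) * ((r * s) ^ y /\<^sub>R fact y)" for y
  proof (rule real_sqrt_unique)
    have "exp (- (r\<^sup>2 + s\<^sup>2) / 2) ^ 2 = exp (- r\<^sup>2) * exp (- s\<^sup>2)"
      by (simp add: exp_double[symmetric] exp_add[symmetric])
    then show "(exp (- (r\<^sup>2 + s\<^sup>2) / 2) * ((r * s) ^ y /\<^sub>R fact y))\<^sup>2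
        = pmf (poi (r\<^sup>2)) y * pmf (poi (s\<^sup>2)) y"
      by (simp add: pmf_poi power_mult_distrib field_simps power2_eq_square)
  qed (use assms in auto)
  moreover have "(\<lambda>y. exp (- (r\<^sup>2 + s\<^sup>2) / 2) * ((r * s) ^ y /\<^sub>R fact y))
      sums (exp (- (r\<^sup>2 + s\<^sup>2) / 2) * exp (r * s))"
    by (intro sums_mult exp_converges)
  moreover have "exp (- (r\<^sup>2 + s\<^sup>2) / 2) * exp (r * s) = exp (- (r - s)\<^sup>2 / 2)"
    by (simp add: exp_add[symmetric] power2_diff field_simps)
  ultimately show ?thesis by simp
qed

text \<open>The rates differ by \<open>2 * r + 1\<close>, so at each \<open>y\<close> the two losses
  add up to at least \<open>2 * r\<^sup>2\<close>. The overlap of the two laws has mass at least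
  \<open>1 / (2 * exp 1)\<close>, whatever \<open>r\<close> is.\<close>

lemma poi_two_point:
  assumes r: "0 \<le> r"
  shows "ennreal (r\<^sup>2 / exp 1) \<le>
    (\<integral>\<^sup>+ y. ennreal ((t y - r\<^sup>2)\<^sup>2) \<partial>poi (r\<^sup>2)) + (\<integral>\<^sup>+ y. ennreal ((t y - (r + 1)\<^sup>2)\<^sup>2) \<partial>poi ((r + 1)\<^sup>2))"
proof -
  let ?p = "pmf (poi (r\<^sup>2))" and ?q = "pmf (poi ((r + 1)\<^sup>2))"
  define e :: real where "e = exp (- 1 / 2)"
  have e2: "e * e = 1 / exp 1"
    by (simp add: e_def exp_add[symmetric] exp_minus field_simps)
  have sq: "(u - v)\<^sup>2 \<le> 2 * (u\<^sup>2 + v\<^sup>2)" for u v :: real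
    using zero_le_power2[of "u + v"] unfolding power2_sum power2_diff by (simp add: algebra_simps)
  have pt: "2 * r\<^sup>2 * (e * sqrt (?p y * ?q y) - e\<^sup>2 / 4 * (?p y + ?q y))
      \<le> ?p y * (t y - r\<^sup>2)\<^sup>2 + ?q y * (t y - (r + 1)\<^sup>2)\<^sup>2" for y
  proof -
    define m where "m = min (?p y) (?q y)"
    define M where "M = max (?p y) (?q y)"
    have mM: "?p y * ?q y = m * M" "?p y + ?q y = m + M" "0 \<le> m" "0 \<le> M" "m \<le> ?p y" "m \<le> ?q y"
      by (auto simp: m_def M_def min_def max_def)
    \<comment> \<open>AM-GM bounds the overlap \<open>m\<close> from below by the affinity, whose sum is explicit. The
      weight \<open>e / 2\<close> maximises the resulting bound \<open>2 x e - 2 x\<^sup>2\<close> over \<open>x\<close>.\<close>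
    have "0 \<le> (sqrt m - e / 2 * sqrt M)\<^sup>2"
      by simp
    also have "\<dots> = m - e * sqrt (m * M) + e\<^sup>2 / 4 * M"
      using mM by (simp add: power2_diff power_mult_distrib real_sqrt_mult power_divide)
    also have "\<dots> \<le> m - (e * sqrt (m * M) - e\<^sup>2 / 4 * (m + M)) "
      using mM by (simp add: field_simps)
    finally have *: "e * sqrt (?p y * ?q y) - e\<^sup>2 / 4 * (?p y + ?q y) \<le> m"
      using mM by simp
    have "2 * (2 * r\<^sup>2) \<le> (2 * r + 1)\<^sup>2"
      using r by (simp add: power2_eq_square algebra_simps)
    also have "\<dots> = ((t y - r\<^sup>2) - (t y - (r + 1)\<^sup>2))\<^sup>2"
      by (simp add: power2_eq_square algebra_simps)
    also have "\<dots> \<le> 2 * ((t y - r\<^sup>2)\<^sup>2 + (t y - (r + 1)\<^sup>2)\<^sup>2)"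
      by (rule sq)
    finally have **: "2 * r\<^sup>2 \<le> (t y - r\<^sup>2)\<^sup>2 + (t y - (r + 1)\<^sup>2)\<^sup>2"
      by simp
    have "2 * r\<^sup>2 * (e * sqrt (?p y * ?q y) - e\<^sup>2 / 4 * (?p y + ?q y)) \<le> 2 * r\<^sup>2 * m"
      using * by (intro mult_left_mono) auto
    also have "\<dots> \<le> m * ((t y - r\<^sup>2)\<^sup>2 + (t y - (r + 1)\<^sup>2)\<^sup>2)"
      using mult_left_mono[OF ** \<open>0 \<le> m\<close>] by (simp add: mult_ac)
    also have "\<dots> \<le> ?p y * (t y - r\<^sup>2)\<^sup>2 + ?q y * (t y - (r + 1)\<^sup>2)\<^sup>2"
      using mM by (simp add: distrib_left add_mono mult_right_mono)
    finally show ?thesis .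
  qed
  have "(\<lambda>y. 2 * r\<^sup>2 * (e * sqrt (?p y * ?q y) - e\<^sup>2 / 4 * (?p y + ?q y)))
      sums (2 * r\<^sup>2 * (e * e - e\<^sup>2 / 4 * (1 + 1)))"
  proof (intro sums_mult sums_diff sums_add)
    show "(\<lambda>y. sqrt (?p y * ?q y)) sums e"
      using poi_affinity_sums[of r "r + 1"] r by (simp add: e_def)
    show "?p sums 1" "?q sums 1"
      using poi_factorial_moment[of "r\<^sup>2" 0] poi_factorial_moment[of "(r + 1)\<^sup>2" 0] by simp_all
  qed
  moreover have "2 * r\<^sup>2 * (e * e - e\<^sup>2 / 4 * (1 + 1)) = r\<^sup>2 / exp 1"
    using e2 by (simp add: power2_eq_square)
  ultimately have S: "(\<lambda>y. 2 * r\<^sup>2 * (e * sqrt (?p y * ?q y) - e\<^sup>2 / 4 * (?p y + ?q y))) sums (r\<^sup>2 / exp 1)"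
    by simp
  \<comment> \<open>An arbitrary \<open>t\<close> may have infinite risk, in which case the bound is
    trivial.\<close>
  have "ennreal (r\<^sup>2 / exp 1) \<le> (\<Sum>y. ennreal (?p y * (t y - r\<^sup>2)\<^sup>2 + ?q y * (t y - (r + 1)\<^sup>2)\<^sup>2))"
  proof (cases "summable (\<lambda>y. ?p y * (t y - r\<^sup>2)\<^sup>2 + ?q y * (t y - (r + 1)\<^sup>2)\<^sup>2)")
    case True
    have "r\<^sup>2 / exp 1 \<le> (\<Sum>y. ?p y * (t y - r\<^sup>2)\<^sup>2 + ?q y * (t y - (r + 1)\<^sup>2)\<^sup>2)"
      using sums_le[OF pt S summable_sums[OF True]] .
    then show ?thesis
      using True by (subst suminf_ennreal2) (auto intro!: ennreal_leI)
  next
    case False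
    then have "(\<Sum>y. ennreal (?p y * (t y - r\<^sup>2)\<^sup>2 + ?q y * (t y - (r + 1)\<^sup>2)\<^sup>2)) = top"
      using summable_suminf_not_top[of "\<lambda>y. ?p y * (t y - r\<^sup>2)\<^sup>2 + ?q y * (t y - (r + 1)\<^sup>2)\<^sup>2"]
      by auto
    then show ?thesis by simp
  qed
  also have "\<dots> = (\<integral>\<^sup>+ y. ennreal ((t y - r\<^sup>2)\<^sup>2) \<partial>poi (r\<^sup>2)) + (\<integral>\<^sup>+ y. ennreal ((t y - (r + 1)\<^sup>2)\<^sup>2) \<partial>poi ((r + 1)\<^sup>2))"
    by (simp add: nn_integral_measure_pmf nn_integral_count_space_nat ennreal_mult[symmetric]
        suminf_add)
  finally show ?thesis .
qed

subsection \<open>Bounds on the two risks\<close>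

lemma nn_integral_Pi_pmf_insert:
  assumes "finite A" "x \<notin> A"
  shows "(\<integral>\<^sup>+ g. f g \<partial>Pi_pmf (insert x A) d p) = (\<integral>\<^sup>+ y. \<integral>\<^sup>+ g. f (g(x := y)) \<partial>Pi_pmf A d p \<partial>p x)"
  by (simp add: Pi_pmf_insert[OF assms] nn_integral_pair_pmf' case_prod_unfold)

text \<open>Here the new coordinate is integrated innermost. This is the order for the observations:
  the last one is averaged with the others held fixed.\<close>

lemma nn_integral_Pi_pmf_insert_rev:
  assumes "finite A" "x \<notin> A"
  shows "(\<integral>\<^sup>+ g. f g \<partial>Pi_pmf (insert x A) d p) = (\<integral>\<^sup>+ g. \<integral>\<^sup>+ y. f (g(x := y)) \<partial>p x \<partial>Pi_pmf A d p)"
  unfolding Pi_pmf_insert[OF assms]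
  by (subst pair_commute_pmf) (simp add: nn_integral_pair_pmf' case_prod_unfold)

text \<open>The risk of \<open>t\<close> given that the last parameter is \<open>b k\<close>.\<close>
definition cond_risk ::
    "nat \<Rightarrow> nat pmf \<Rightarrow> ((nat \<Rightarrow> nat) \<Rightarrow> real) \<Rightarrow> (nat \<Rightarrow> real) \<Rightarrow> nat \<Rightarrow> ennreal" where
  "cond_risk n q t b k =
    (\<integral>\<^sup>+ \<kappa>. \<integral>\<^sup>+ y. \<integral>\<^sup>+ v. ennreal ((t (restrict (y(n := v)) {1..n}) - b k)\<^sup>2)
      \<partial>poi (b k) \<partial>Pi_pmf {1..<n} 0 (\<lambda>i. poi (b (\<kappa> i))) \<partial>Pi_pmf {1..<n} 0 (\<lambda>_. q))"

lemma risk_conv_cond_risk: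
  assumes "\<And>k. 0 \<le> b k" "n \<ge> 1"
  shows "risk n (discrete_prior q b) t = (\<integral>\<^sup>+ k. cond_risk n q t b k \<partial>q)"
proof -
  have I: "{1..n} = insert n {1..<n}"
    using assms(2) by auto
  show ?thesis
    unfolding risk_discrete_prior[OF assms, where d = 0 and d' = 0] cond_risk_def
    unfolding I
  proof (subst nn_integral_Pi_pmf_insert, simp, simp, intro nn_integral_cong)
    fix k :: nat and \<kappa> :: "nat \<Rightarrow> nat"
    \<comment> \<open>The last label affects only the law of the last observation.\<close>
    have *: "Pi_pmf {1..<n} 0 (\<lambda>i. poi (b ((\<kappa>(n := k)) i))) = Pi_pmf {1..<n} 0 (\<lambda>i. poi (b (\<kappa> i)))"
      by (intro Pi_pmf_cong) auto
    show "(\<integral>\<^sup>+ y. ennreal ((t (restrict y (insert n {1..<n})) - b ((\<kappa>(n := k)) n))\<^sup>2)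
        \<partial>Pi_pmf (insert n {1..<n}) 0 (\<lambda>i. poi (b ((\<kappa>(n := k)) i))))
      = (\<integral>\<^sup>+ y. \<integral>\<^sup>+ v. ennreal ((t (restrict (y(n := v)) (insert n {1..<n})) - b k)\<^sup>2)
        \<partial>poi (b k) \<partial>Pi_pmf {1..<n} 0 (\<lambda>i. poi (b (\<kappa> i))))"
      by (subst nn_integral_Pi_pmf_insert_rev) (simp_all only: * finite_atLeastLessThan
        atLeastLessThan_iff less_irrefl simp_thms fun_upd_same)
  qed
qed

text \<open>If no other parameter sits at position \<open>k\<close>, then the first \<open>n - 1\<close> observations carry no
  information on which of the two priors is the true one.\<close>
lemma cond_risk_two_point:
  assumes bb': "\<And>j. j \<noteq> k \<Longrightarrow> b j = b' j"
    and r: "0 \<le> r" "b k = r\<^sup>2" "b' k = (r + 1)\<^sup>2"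
  shows "ennreal ((1 - pmf q k) ^ (n - 1) * (r\<^sup>2 / exp 1)) \<le> cond_risk n q t b k + cond_risk n q t b' k"
proof -
  let ?I = "{1..<n}" and ?E = "{\<kappa>. \<forall>i\<in>{1..<n}. \<kappa> i \<noteq> k} :: (nat \<Rightarrow> nat) set"
  let ?Q = "Pi_pmf ?I 0 (\<lambda>_. q)"
  let ?P = "\<lambda>b \<kappa>. Pi_pmf ?I 0 (\<lambda>i. poi (b (\<kappa> i)))"
  let ?l = "\<lambda>y v. t (restrict (y(n := v)) {1..n})"
  let ?f = "\<lambda>b y. \<integral>\<^sup>+ v. ennreal ((?l y v - b k)\<^sup>2) \<partial>poi (b k)"
  have E: "emeasure ?Q ?E = ennreal ((1 - pmf q k) ^ (n - 1))"
  proof -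
    have "?E = Pi ?I (\<lambda>_. - {k})"
      by auto
    moreover have "measure_pmf.prob q (- {k}) = 1 - pmf q k"
      using measure_pmf.prob_compl[of "{k}" q] by (simp add: Compl_eq_Diff_UNIV measure_pmf_single)
    ultimately show ?thesis
      by (simp add: measure_pmf.emeasure_eq_measure measure_Pi_pmf_Pi)
  qed
  have P: "?P b' \<kappa> = ?P b \<kappa>" if "\<kappa> \<in> ?E" for \<kappa>
    using that bb' by (intro Pi_pmf_cong) auto
  have "ennreal ((1 - pmf q k) ^ (n - 1) * (r\<^sup>2 / exp 1)) = (\<integral>\<^sup>+ \<kappa>. ennreal (r\<^sup>2 / exp 1) * indicator ?E \<kappa> \<partial>?Q)"
    by (subst nn_integral_cmult_indicator, simp, unfold E)
       (simp add: ennreal_mult[symmetric] pmf_le_1 mult.commute)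
  also have "\<dots> \<le> (\<integral>\<^sup>+ \<kappa>. (\<integral>\<^sup>+ y. ?f b y \<partial>?P b \<kappa>) + (\<integral>\<^sup>+ y. ?f b' y \<partial>?P b' \<kappa>) \<partial>?Q)"
  proof (rule nn_integral_mono)
    fix \<kappa>
    show "ennreal (r\<^sup>2 / exp 1) * indicator ?E \<kappa> \<le> (\<integral>\<^sup>+ y. ?f b y \<partial>?P b \<kappa>) + (\<integral>\<^sup>+ y. ?f b' y \<partial>?P b' \<kappa>)"
    proof (cases "\<kappa> \<in> ?E")
      case True
      have "ennreal (r\<^sup>2 / exp 1) = (\<integral>\<^sup>+ y. ennreal (r\<^sup>2 / exp 1) \<partial>?P b \<kappa>)"
        by (simp add: measure_pmf.emeasure_space_1[simplified])
      \<comment> \<open>With the earlier observations \<open>y\<close> frozen,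
        \<open>\<lambda>v. ?l y v\<close> is an estimator based on a single observation.\<close>
      also have "\<dots> \<le> (\<integral>\<^sup>+ y. ?f b y + ?f b' y \<partial>?P b \<kappa>)"
        unfolding r(2,3) by (intro nn_integral_mono poi_two_point r(1))
      also have "\<dots> = (\<integral>\<^sup>+ y. ?f b y \<partial>?P b \<kappa>) + (\<integral>\<^sup>+ y. ?f b' y \<partial>?P b \<kappa>)"
        by (rule nn_integral_add) auto
      finally show ?thesis
        unfolding P[OF True] using True by simp
    qed simp
  qed
  also have "\<dots> = cond_risk n q t b k + cond_risk n q t b' k"
    unfolding cond_risk_def by (rule nn_integral_add) auto
  finally show ?thesis .
qed

text \<open>Guess the location nearest to the observation. If it is wrong, the error is at least
  \<open>L\<close> and at most twice the deviation \<open>x\<close> of the observation from its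
  mean. So the squared error is at most \<open>(2 * x) ^ 4 / L\<^sup>2\<close>, and the fourth
  central moment bounds its mean.\<close>

lemma mmse_discrete_prior_le:
  assumes b: "\<And>k. 0 \<le> b k" and A: "finite A" "set_pmf q \<subseteq> A" and L: "0 < L"
    and sep: "\<And>j k. j \<in> A \<Longrightarrow> k \<in> A \<Longrightarrow> j \<noteq> k \<Longrightarrow> L \<le> \<bar>b j - b k\<bar>"
  shows "mmse (discrete_prior q b) \<le> (\<integral>\<^sup>+ k. ennreal (16 / L\<^sup>2 * (3 * (b k)\<^sup>2 + b k)) \<partial>q)"
proof -
  define c where "c y = arg_min_on (\<lambda>j. \<bar>real y - b j\<bar>) A" for y
  define h where "h y = b (c y)" for y
  have ne: "A \<noteq> {}"
    using A(2) set_pmf_not_empty[of q] by auto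
  have c: "c y \<in> A" "k \<in> A \<Longrightarrow> \<bar>real y - b (c y)\<bar> \<le> \<bar>real y - b k\<bar>" for y k
    unfolding c_def using arg_min_if_finite[OF A(1) ne, of "\<lambda>j. \<bar>real y - b j\<bar>"]
    by (auto simp: not_less)
  have pt: "(h y - b k)\<^sup>2 \<le> 16 / L\<^sup>2 * (real y - b k) ^ 4" if k: "k \<in> A" for y k
  proof (cases "c y = k")
    case False
    define x where "x = \<bar>real y - b k\<bar>"
    have "\<bar>h y - b k\<bar> = \<bar>(real y - b k) - (real y - h y)\<bar>"
      by simp
    also have "\<dots> \<le> x + \<bar>real y - h y\<bar>"
      unfolding x_def by (rule abs_triangle_ineq4)
    finally have d: "\<bar>h y - b k\<bar> \<le> 2 * x" "L \<le> \<bar>h y - b k\<bar>"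
      using c(2)[OF k, of y] sep[OF c(1) k False] by (simp_all add: h_def x_def)
    have "(h y - b k)\<^sup>2 * L\<^sup>2 \<le> (2 * x)\<^sup>2 * (2 * x)\<^sup>2"
      using d L by (intro mult_mono abs_le_square_iff[THEN iffD1]) auto
    also have "\<dots> = 16 * (real y - b k) ^ 4"
      by (simp add: x_def power_even_abs power_mult_distrib flip: power_add)
    finally show ?thesis
      using L by (simp add: field_simps)
  qed (simp add: h_def)
  have "mmse (discrete_prior q b)
      \<le> (\<integral>\<^sup>+ (\<theta>, y). ennreal ((h y - \<theta>)\<^sup>2) \<partial>poisson_mixture (discrete_prior q b))"
    unfolding mmse_def by (rule INF_lower) simp
  also have "\<dots> = (\<integral>\<^sup>+ k. \<integral>\<^sup>+ y. ennreal ((h y - b k)\<^sup>2) \<partial>poi (b k) \<partial>q)"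
    by (rule nn_integral_poisson_mixture[OF b])
  also have "\<dots> \<le> (\<integral>\<^sup>+ k. ennreal (16 / L\<^sup>2 * (3 * (b k)\<^sup>2 + b k)) \<partial>q)"
  proof (intro nn_integral_mono_AE AE_pmfI)
    fix k assume "k \<in> set_pmf q"
    then have k: "k \<in> A" using A by auto
    have "(\<integral>\<^sup>+ y. ennreal ((h y - b k)\<^sup>2) \<partial>poi (b k))
        \<le> (\<integral>\<^sup>+ y. ennreal (16 / L\<^sup>2) * ennreal ((real y - b k) ^ 4) \<partial>poi (b k))"
      using pt[OF k] by (intro nn_integral_mono) (simp add: ennreal_leI flip: ennreal_mult)
    also have "\<dots> = ennreal (16 / L\<^sup>2) * ennreal (3 * (b k)\<^sup>2 + b k)"
      by (simp add: nn_integral_cmult poi_fourth_central_moment[OF b])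
    also have "\<dots> = ennreal (16 / L\<^sup>2 * (3 * (b k)\<^sup>2 + b k))"
      using b by (intro ennreal_mult[symmetric]) auto
    finally show "(\<integral>\<^sup>+ y. ennreal ((h y - b k)\<^sup>2) \<partial>poi (b k)) \<le> ennreal (16 / L\<^sup>2 * (3 * (b k)\<^sup>2 + b k))" .
  qed
  finally show ?thesis .
qed

section \<open>Averaging over all choices of locations\<close>

lemma ennreal_exists_ge_average:
  fixes f :: "'a \<Rightarrow> ennreal"
  assumes A: "finite A" "A \<noteq> {}" and le: "of_nat (card A) * c \<le> (\<Sum>x\<in>A. f x)"
  shows "\<exists>x\<in>A. c \<le> f x"
proof -
  have "Max (f ` A) \<in> f ` A"
    using A by (intro Max_in) auto
  then obtain x where x: "x \<in> A" "f x = Max (f ` A)"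
    by (metis imageE)
  have "(\<Sum>x\<in>A. f x) \<le> of_nat (card A) * f x"
    using A by (intro sum_bounded_above) (simp add: x(2))
  with le have "of_nat (card A) * c \<le> of_nat (card A) * f x"
    by (rule order_trans)
  then have "c \<le> f x"
    using A by (subst (asm) ennreal_mult_le_mult_iff) auto
  then show ?thesis using x(1) by blast
qed

text \<open>Toggling \<open>k\<close> partitions \<open>Pow A\<close> into
  \<open>2 ^ (card A - 1)\<close> pairs, each contributing at least \<open>c\<close>.\<close>

lemma sum_Pow_ge_pairs:
  fixes f :: "'a set \<Rightarrow> ennreal"
  assumes "finite A" "k \<in> A" and le: "\<And>S. S \<subseteq> A - {k} \<Longrightarrow> c \<le> f S + f (insert k S)"
  shows "2 ^ (card A - 1) * c \<le> (\<Sum>S\<in>Pow A. f S)"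
proof -
  let ?B = "A - {k}"
  have "2 ^ (card A - 1) * c = (\<Sum>S\<in>Pow ?B. c)"
    using assms by (simp add: card_Pow)
  also have "\<dots> \<le> (\<Sum>S\<in>Pow ?B. f S + f (insert k S))"
    by (intro sum_mono le) auto
  also have "\<dots> = (\<Sum>S\<in>Pow ?B. f S) + (\<Sum>S\<in>insert k ` Pow ?B. f S)"
    by (subst sum.reindex) (auto simp: sum.distrib inj_on_def)
  also have "\<dots> = (\<Sum>S\<in>Pow ?B \<union> insert k ` Pow ?B. f S)"
    using assms by (intro sum.union_disjoint[symmetric]) auto
  also have "Pow ?B \<union> insert k ` Pow ?B = Pow A"
    using assms by (subst Pow_insert[symmetric]) (auto simp: insert_absorb)
  finally show ?thesis .
qed

text \<open>Position \<open>0\<close> absorbs the remaining mass \<open>1 - N * w\<close>.\<close>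

lemma exists_pmf_equal_weights:
  assumes "0 \<le> w" "real N * w \<le> 1"
  obtains q :: "nat pmf" where "set_pmf q \<subseteq> {0..N}" "\<And>k. k \<in> {1..N} \<Longrightarrow> pmf q k = w"
proof -
  define f where "f k = (if k = 0 then 1 - real N * w else if k \<le> N then w else 0)" for k
  have f0: "0 \<le> f k" for k
    using assms by (simp add: f_def)
  have "(\<Sum>k\<in>{0..N}. f k) = f 0 + (\<Sum>k\<in>{1..N}. w)"
    by (subst sum.atLeast_Suc_atMost) (auto simp: f_def intro!: sum.cong)
  then have s: "(\<Sum>k\<in>{0..N}. f k) = 1"
    by (simp add: f_def)
  have "(\<integral>\<^sup>+ k. ennreal (f k) \<partial>count_space UNIV) = (\<Sum>k\<in>{0..N}. ennreal (f k))"
    by (rule nn_integral_count_space') (auto simp: f_def)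
  also have "\<dots> = 1"
    using f0 s by (simp add: sum_ennreal)
  finally have p: "pmf (embed_pmf f) k = f k" for k
    using f0 by (intro pmf_embed_pmf)
  show ?thesis
    by (rule that[of "embed_pmf f"]) (auto simp: p set_pmf_eq f_def split: if_splits)
qed

subsection \<open>The hard priors\<close>

text \<open>The supremum lies inside the infimum, so the hard prior may depend on the estimator;
  only the bounds \<open>a\<close> and \<open>m\<close> must be uniform.\<close>

lemma regret_ge:
  assumes "\<And>t. \<exists>G\<in>\<G>. ennreal a \<le> risk n G t \<and> mmse G \<le> ennreal m" "0 \<le> a" "0 \<le> m"
  shows "ereal (a - m) \<le> regret n \<G>"
  unfolding regret_def
proof (rule INF_greatest)
  fix t
  obtain G where G: "G \<in> \<G>" "ennreal a \<le> risk n G t" "mmse G \<le> ennreal m"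
    using assms(1) by blast
  have "ereal a - ereal m \<le> enn2ereal (risk n G t) - enn2ereal (mmse G)"
    using G(2,3) assms(2,3)
    by (intro ereal_minus_mono) (simp_all add: less_eq_ennreal.rep_eq enn2ereal_ennreal)
  then have "ereal (a - m) \<le> enn2ereal (risk n G t) - enn2ereal (mmse G)"
    by simp
  then show "ereal (a - m) \<le> (SUP G\<in>\<G>. enn2ereal (risk n G t) - enn2ereal (mmse G))"
    using G(1) by (intro SUP_upper2)
qed

text \<open>The square root stabilises the variance of the Poisson law, so the spacing is uniform on the
  square-root scale: a toggle moves a location by \<open>1\<close>, which one observation cannot detect, while
  distinct positions stay \<open>100\<close> apart, which makes the nearest location a good guess. Position \<open>0\<close>
  carries the remaining mass, at parameter \<open>0\<close>.\<close>
definition locations :: "real \<Rightarrow> nat set \<Rightarrow> nat \<Rightarrow> real" where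
  "locations R S k = (if k = 0 then 0 else (R + 101 * (real k - 1) + of_bool (k \<in> S))\<^sup>2)"

lemma locations_nonneg: "0 \<le> locations R S k"
  by (simp add: locations_def)

text \<open>The square roots of the nonzero locations start at \<open>R\<close> and end at or below
  \<open>R + 101 * (N - 1) + 1\<close>, which is at most \<open>2 * R\<close>.\<close>

lemma locations_bounds:
  assumes "200 \<le> R" "101 * real N \<le> R" "k \<in> {1..N}"
  shows "R \<le> R + 101 * (real k - 1)" "locations R S k \<le> 4 * R\<^sup>2"
proof -
  have k: "1 \<le> real k" "real k \<le> real N"
    using assms(3) by auto
  then show "R \<le> R + 101 * (real k - 1)"
    by simp
  have "locations R S k = (R + 101 * (real k - 1) + of_bool (k \<in> S))\<^sup>2"
    using assms(3) by (simp add: locations_def)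
  also have "\<dots> \<le> (2 * R)\<^sup>2"
    using assms k by (intro power_mono) (auto simp: of_bool_def)
  finally show "locations R S k \<le> 4 * R\<^sup>2"
    by (simp add: power_mult_distrib)
qed

text \<open>Square roots of nonzero locations differ by at least 101 - 1 and add up to at least
  \<open>2 * R\<close>; factor the difference of squares. The gap next to \<open>0\<close> is at
  least \<open>R\<^sup>2\<close>, whence \<open>200 \<le> R\<close>.\<close>

lemma locations_separated:
  assumes R: "200 \<le> R" and jk: "j \<in> {0..N}" "k \<in> {0..N}" "j \<noteq> k"
  shows "200 * R \<le> \<bar>locations R S j - locations R S k\<bar>"
proof -
  have *: "200 * R \<le> locations R S k - locations R S j" if "j < k" for j k
  proof (cases "j = 0")
    case True
    have "200 * R \<le> R * R"
      using R by (intro mult_right_mono) auto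
    also have "R * R \<le> (R + 101 * (real k - 1) + of_bool (k \<in> S)) * (R + 101 * (real k - 1) + of_bool (k \<in> S))"
      using R that by (intro mult_mono) auto
    finally show ?thesis
      using True that by (simp add: locations_def power2_eq_square)
  next
    case False
    define u where "u = R + 101 * (real k - 1) + of_bool (k \<in> S)"
    define v where "v = R + 101 * (real j - 1) + of_bool (j \<in> S)"
    have r: "1 \<le> real j" "real j + 1 \<le> real k"
      using that False by auto
    then have uv: "R \<le> v" "v + 100 \<le> u"
      by (auto simp: u_def v_def)
    have "100 * (2 * R) \<le> (u - v) * (u + v)"
      using uv R by (intro mult_mono) auto
    moreover have "locations R S k = u\<^sup>2" "locations R S j = v\<^sup>2"
      using that False by (simp_all add: locations_def u_def v_def)
    ultimately show ?thesis
      by (simp add: power2_eq_square algebra_simps)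
  qed
  show ?thesis
    using *[of j k] *[of k j] jk(3) by linarith
qed

lemma locations_toggle:
  assumes "k \<notin> S"
  shows "j \<noteq> k \<Longrightarrow> locations R (insert k S) j = locations R S j"
    and "k \<noteq> 0 \<Longrightarrow> locations R S k = (R + 101 * (real k - 1))\<^sup>2"
    and "k \<noteq> 0 \<Longrightarrow> locations R (insert k S) k = (R + 101 * (real k - 1) + 1)\<^sup>2"
  using assms by (auto simp: locations_def)

text \<open>\<open>2 * n * w \<le> 1\<close> leaves a given position free of other parameters with
  probability at least 1/2, and the bound by \<open>M\<close> puts all the priors into the class.
  The constant is 1/12 (risk) minus 1/48 (Bayes risk).\<close>

lemma regret_moment_class_ge:
  assumes p: "0 < p" and n: "n \<ge> 1" and N: "1 \<le> N" "101 * real N \<le> R" and R: "200 \<le> R"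
    and w: "0 \<le> w" "real N * w \<le> 1" "2 * real n * w \<le> 1"
    and M: "real N * w * (4 * R\<^sup>2) powr p \<le> M"
  shows "ereal (real N * w * R\<^sup>2 / 16) \<le> regret n (moment_class p M)"
proof -
  obtain q :: "nat pmf" where q: "set_pmf q \<subseteq> {0..N}" "\<And>k. k \<in> {1..N} \<Longrightarrow> pmf q k = w"
    using exists_pmf_equal_weights[OF w(1,2)] by blast
  let ?b = "locations R" and ?G = "\<lambda>S. discrete_prior q (locations R S)"
  have int_q: "(\<integral>\<^sup>+ k. g k \<partial>q) = g 0 * ennreal (pmf q 0) + (\<Sum>k\<in>{1..N}. g k * ennreal w)" for g
  proof -
    have "(\<integral>\<^sup>+ k. g k \<partial>q) = (\<Sum>k\<in>{0..N}. g k * ennreal (pmf q k))"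
      using q(1) by (intro nn_integral_measure_pmf_support) auto
    also have "\<dots> = g 0 * ennreal (pmf q 0) + (\<Sum>k\<in>{1..N}. g k * ennreal (pmf q k))"
      by (subst sum.atLeast_Suc_atMost) auto
    finally show ?thesis using q(2) by simp
  qed
  have int_q_le: "(\<integral>\<^sup>+ k. ennreal (g k) \<partial>q) \<le> ennreal (real N * w * B)"
    if "g 0 = 0" "\<And>k. k \<in> {1..N} \<Longrightarrow> g k \<le> B" for g B
  proof -
    have "(\<integral>\<^sup>+ k. ennreal (g k) \<partial>q) = (\<Sum>k\<in>{1..N}. ennreal (g k) * ennreal w)"
      unfolding int_q by (simp add: that(1))
    also have "\<dots> \<le> (\<Sum>k\<in>{1..N}. ennreal B * ennreal w)"
      by (intro sum_mono mult_right_mono ennreal_leI that(2)) auto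
    also have "\<dots> = ennreal (real N * w * B)"
      using w by (simp add: ennreal_of_nat_eq_real_of_nat mult.commute[of "ennreal B"] mult.assoc ennreal_mult')
    finally show ?thesis .
  qed
  have G: "?G S \<in> moment_class p M" for S
  proof -
    have "moment p (?G S) = (\<integral>\<^sup>+ k. ennreal (?b S k powr p) \<partial>q)"
      unfolding moment_def
      by (intro nn_integral_discrete_prior locations_nonneg measurable_compose[OF _ measurable_ennreal]
          borel_measurable_nonneg_borel) simp
    also have "\<dots> \<le> ennreal (real N * w * (4 * R\<^sup>2) powr p)"
    proof (rule int_q_le)
      fix k assume "k \<in> {1..N}"
      then show "?b S k powr p \<le> (4 * R\<^sup>2) powr p"
        using p R N locations_bounds(2) locations_nonneg by (intro powr_mono2) auto
    qed (simp add: locations_def)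
    also have "\<dots> \<le> ennreal M"
      using M by (rule ennreal_leI)
    finally show ?thesis
      by (simp add: moment_class_def discrete_prior_in_priors locations_nonneg)
  qed
  have mmse: "mmse (?G S) \<le> ennreal (real N * w * (R\<^sup>2 / 48))" for S
  proof -
    have "mmse (?G S) \<le> (\<integral>\<^sup>+ k. ennreal (16 / (200 * R)\<^sup>2 * (3 * (?b S k)\<^sup>2 + ?b S k)) \<partial>q)"
      using R q(1) locations_separated by (intro mmse_discrete_prior_le locations_nonneg) auto
    also have "\<dots> \<le> ennreal (real N * w * (R\<^sup>2 / 48))"
    proof (rule int_q_le)
      fix k assume "k \<in> {1..N}"
      then have b: "?b S k \<le> 4 * R\<^sup>2"
        using locations_bounds(2) R N by blast
      \<comment> \<open>Here 52 = 3 * 16 + 4, and 16 * 52 / 200 ^ 2 = 0.0208 lies just below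
        1/48.\<close>
      have "R\<^sup>2 * 1 \<le> R\<^sup>2 * R\<^sup>2"
        using R by (intro mult_left_mono) auto
      moreover have "(?b S k)\<^sup>2 \<le> (4 * R\<^sup>2)\<^sup>2"
        using b locations_nonneg by (intro power_mono)
      ultimately have "3 * (?b S k)\<^sup>2 + ?b S k \<le> 52 * (R\<^sup>2 * R\<^sup>2)"
        using b by (simp add: power_mult_distrib power2_eq_square[of "R\<^sup>2"])
      then have "16 / (200 * R)\<^sup>2 * (3 * (?b S k)\<^sup>2 + ?b S k) \<le> 16 / (200 * R)\<^sup>2 * (52 * (R\<^sup>2 * R\<^sup>2))"
        by (intro mult_left_mono) auto
      also have "\<dots> = 832 / 40000 * R\<^sup>2"
        using R by (simp add: field_simps power2_eq_square)
      also have "\<dots> \<le> R\<^sup>2 / 48"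
        by simp
      finally show "16 / (200 * R)\<^sup>2 * (3 * (?b S k)\<^sup>2 + ?b S k) \<le> R\<^sup>2 / 48" .
    qed (simp add: locations_def)
    finally show ?thesis .
  qed
  have risk: "\<exists>S. ennreal (real N * w * (R\<^sup>2 / 12)) \<le> risk n (?G S) t" for t
  proof -
    let ?A = "{1..N}"
    have pair: "ennreal (R\<^sup>2 / 6) \<le> cond_risk n q t (?b S) k + cond_risk n q t (?b (insert k S)) k"
      if k: "k \<in> ?A" and S: "S \<subseteq> ?A - {k}" for k S
    proof -
      let ?r = "R + 101 * (real k - 1)"
      have kS: "k \<notin> S" "k \<noteq> 0"
        using S k by auto
      have r: "R \<le> ?r"
        using locations_bounds(1)[OF R N(2) k] .
      have "1 / 2 \<le> 1 + real (n - 1) * (- w)"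
        using w n by (simp add: of_nat_diff algebra_simps)
      also have "\<dots> \<le> (1 + (- w)) ^ (n - 1)"
      proof (rule Bernoulli_inequality)
        have "2 * 1 * w \<le> 2 * real n * w"
          using n w by (intro mult_right_mono) auto
        then show "- 1 \<le> - w" using w by simp
      qed
      finally have half: "1 / 2 \<le> (1 - w) ^ (n - 1)"
        by simp
      \<comment> \<open>Since \<open>exp 1 \<le> 3\<close>, the two-point bound times the
        probability 1/2 of a free position leaves 1/6.\<close>
      have "R\<^sup>2 / 3 \<le> ?r\<^sup>2 / exp 1"
        using r R exp_le by (intro frac_le power_mono) auto
      then have "1 / 2 * (R\<^sup>2 / 3) \<le> (1 - w) ^ (n - 1) * (?r\<^sup>2 / exp 1)"
        using half by (intro mult_mono) auto
      then have "ennreal (R\<^sup>2 / 6) \<le> ennreal ((1 - pmf q k) ^ (n - 1) * (?r\<^sup>2 / exp 1))"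
        using q(2)[OF k] by (intro ennreal_leI) simp
      also have "\<dots> \<le> cond_risk n q t (?b S) k + cond_risk n q t (?b (insert k S)) k"
        using r R kS by (intro cond_risk_two_point) (auto simp: locations_toggle)
      finally show ?thesis .
    qed
    \<comment> \<open>Each of the \<open>N\<close> positions, of weight \<open>w\<close>, yields
      \<open>2 ^ (N - 1)\<close> pairs worth \<open>R\<^sup>2 / 6\<close>; averaging over
      \<open>2 ^ N\<close> sets halves this to 1/12.\<close>
    have "of_nat (card (Pow ?A)) * ennreal (real N * w * (R\<^sup>2 / 12))
        = (\<Sum>k\<in>?A. 2 ^ (card ?A - 1) * ennreal (R\<^sup>2 / 6) * ennreal w)"
    proof -
      have e2: "2 ^ m = ennreal (2 ^ m)" for m
        by (simp flip: ennreal_power)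
      have e3: "ennreal a * ennreal b * ennreal w = ennreal (a * b * w)" if "0 \<le> a" "0 \<le> b" for a b
        using that w by (simp add: ennreal_mult)
      have c: "of_nat (card (Pow ?A)) = ennreal (2 ^ N)"
        by (simp add: card_Pow e2)
      have "of_nat (card (Pow ?A)) * ennreal (real N * w * (R\<^sup>2 / 12)) = ennreal (2 ^ N * (real N * w * (R\<^sup>2 / 12)))"
        unfolding c by (rule ennreal_mult[symmetric]) (use w in auto)
      also have "2 ^ N * (real N * w * (R\<^sup>2 / 12)) = real N * (2 ^ (N - 1) * (R\<^sup>2 / 6) * w)"
        using N(1) by (cases N) (auto simp: field_simps)
      also have "ennreal \<dots> = of_nat (card ?A) * ennreal (2 ^ (N - 1) * (R\<^sup>2 / 6) * w)"
        unfolding ennreal_of_nat_eq_real_of_nat card_atLeastAtMost diff_Suc_1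
        by (rule ennreal_mult') simp
      also have "\<dots> = (\<Sum>k\<in>?A. 2 ^ (card ?A - 1) * ennreal (R\<^sup>2 / 6) * ennreal w)"
        unfolding e2 by (subst e3) auto
      finally show ?thesis .
    qed
    also have "\<dots> \<le> (\<Sum>k\<in>?A. (\<Sum>S\<in>Pow ?A. cond_risk n q t (?b S) k) * ennreal w)"
    proof (intro sum_mono mult_right_mono sum_Pow_ge_pairs)
      fix k S assume "k \<in> ?A" "S \<subseteq> ?A - {k}"
      then show "ennreal (R\<^sup>2 / 6) \<le> cond_risk n q t (?b S) k + cond_risk n q t (?b (insert k S)) k"
        by (rule pair)
    qed auto
    also have "\<dots> = (\<Sum>S\<in>Pow ?A. \<Sum>k\<in>?A. cond_risk n q t (?b S) k * ennreal w)"
      unfolding sum_distrib_right by (rule sum.swap)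
    \<comment> \<open>The nonnegative contribution of position \<open>0\<close> is dropped.\<close>
    also have "\<dots> \<le> (\<Sum>S\<in>Pow ?A. risk n (?G S) t)"
      unfolding risk_conv_cond_risk[OF locations_nonneg n] int_q by (intro sum_mono) simp
    finally show ?thesis
      using ennreal_exists_ge_average[of "Pow ?A"] by blast
  qed
  have "ereal (real N * w * (R\<^sup>2 / 12) - real N * w * (R\<^sup>2 / 48)) \<le> regret n (moment_class p M)"
    using risk mmse G w by (intro regret_ge) (blast, auto)
  then show ?thesis
    by (simp add: field_simps)
qed

lemma regret_moment_class_one_ge:
  assumes "n \<ge> 1" "0 < M"
  shows "ereal (M / 64) \<le> regret n (moment_class 1 M)"
proof -
  \<comment> \<open>One location with \<open>w = M / (4 * R\<^sup>2)\<close> has mean at most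
    \<open>M\<close>, and \<open>w * R\<^sup>2\<close> does not depend on \<open>R\<close>. So
    \<open>R\<close> may be taken large enough for \<open>2 * n * w \<le> 1\<close>, for any
    \<open>M\<close>.\<close>
  define R where "R = 200 + real n * M"
  have nM: "0 < real n * M"
    using assms by simp
  then have R: "200 \<le> R" "0 < R"
    by (simp_all add: R_def)
  have "real n * M \<le> R * 1"
    by (simp add: R_def)
  also have "\<dots> \<le> R * R"
    using R by (intro mult_left_mono) auto
  finally have w: "2 * real n * (M / (4 * R\<^sup>2)) \<le> 1"
    using nM R by (simp add: field_simps power2_eq_square)
  have "1 * (M / (4 * R\<^sup>2)) \<le> 2 * real n * (M / (4 * R\<^sup>2))"
    using assms by (intro mult_right_mono) auto
  with w have "real 1 * (M / (4 * R\<^sup>2)) \<le> 1"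
    by simp
  with w have "ereal (real 1 * (M / (4 * R\<^sup>2)) * R\<^sup>2 / 16) \<le> regret n (moment_class 1 M)"
    using assms R by (intro regret_moment_class_ge) simp_all
  moreover have "real 1 * (M / (4 * R\<^sup>2)) * R\<^sup>2 / 16 = M / 64"
    using R by simp
  ultimately show ?thesis by (simp only:)
qed

text \<open>With \<open>N\<close> of order \<open>R\<close> and \<open>w\<close> of order
  \<open>1 / n\<close>, the moment \<open>N * w * R powr (2 * p)\<close> matches \<open>M\<close>
  when \<open>R\<close> is of order \<open>S = (n * M) powr (1 / (2 * p + 1))\<close>, and the
  regret \<open>N * w * R\<^sup>2\<close> is of order \<open>S ^ 3 / n\<close>. The logarithms keep
  the total mass at most 1.\<close>

lemma regret_moment_class_ge_rate:
  fixes p M :: real and n :: nat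
  defines "K \<equiv> (4 * 6400\<^sup>2) powr p"
  assumes p: "1 \<le> p" and n: "n \<ge> 2" and M: "0 < M"
    and lower: "real n powr (- 1 / p) * ln (real n) ^ 10 \<le> M powr (1 / p)"
    and upper: "M powr (1 / p) \<le> real n ^ 2 * ln (real n) ^ 2"
  shows "ereal (1 / (2 ^ 11 * K) * real n powr (- 2 * (p - 1) / (2 * p + 1)) * M powr (3 / (2 * p + 1))
      * ln (real n) powr (- 11)) \<le> regret n (moment_class p M)"
proof -
  define L where "L = ln (real n)"
  define S where "S = (real n * M) powr (1 / (2 * p + 1))"
  have p': "0 < 2 * p + 1" "p \<noteq> 0"
    using p by auto
  have n0: "0 < real n"
    using n by simp
  have "ln 2 \<le> L"
    unfolding L_def using n by simp
  then have L: "1 / 2 \<le> L"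
    using ln2_ge_two_thirds by simp
  have S0: "0 < S"
    using n0 M by (simp add: S_def)
  have Spow: "S powr (2 * p + 1) = real n * M"
    using p' n0 M by (simp add: S_def powr_powr)
  have Mp: "(M powr (1 / p)) powr p = M"
    using p' M by (simp add: powr_powr)
  have np: "(real n powr (- 1 / p)) powr p = 1 / real n"
    using n0 p' by (simp add: powr_powr powr_neg_one)
  \<comment> \<open>The lower bound on \<open>M\<close> gives
    \<open>n * M \<ge> L powr (10 * p)\<close>. As \<open>10 * p / (2 * p + 1) \<le> 5\<close>, this
    yields \<open>S \<ge> (1 / 2) ^ 5\<close>.\<close>
  have "(1 / 2) powr (10 * p) \<le> real n * M"
  proof -
    have "(1 / 2) powr (10 * p) = ((1 / 2) powr 10) powr p"
      by (simp only: powr_powr)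
    also have "\<dots> \<le> (L ^ 10) powr p"
      using L p power_mono[of "1 / 2" L 10] by (intro powr_mono2) (simp_all add: powr_numeral)
    also have "\<dots> = real n * (real n powr (- 1 / p) * L ^ 10) powr p"
      using n0 L np by (simp add: powr_mult)
    also have "\<dots> \<le> real n * (M powr (1 / p)) powr p"
      using lower p n0 L by (intro mult_left_mono powr_mono2) (auto simp: L_def)
    finally show ?thesis by (simp add: Mp)
  qed
  then have "((1 / 2) powr (10 * p)) powr (1 / (2 * p + 1)) \<le> S"
    unfolding S_def using p by (intro powr_mono2) auto
  moreover have "(1 / 2 :: real) powr 5 \<le> (1 / 2) powr (10 * p / (2 * p + 1))"
    using p by (intro powr_mono') (auto simp: field_simps)
  ultimately have S1: "1 / 32 \<le> S"
    by (simp add: powr_powr powr_numeral power_divide)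
  have S2: "S \<le> 2 * real n * L"
  proof -
    have "real n * M \<le> real n * (real n ^ 2 * L ^ 2) powr p"
      using powr_mono2[OF _ _ upper, of p] p n0 by (simp add: Mp L_def)
    also have "real n ^ 2 * L ^ 2 = (real n * L) powr 2"
      using n0 L by (simp add: power_mult_distrib powr_numeral)
    also have "((real n * L) powr 2) powr p = (real n * L) powr (2 * p)"
      by (rule powr_powr)
    \<comment> \<open>Since \<open>1 \<le> 2 * L\<close>, the lone factor \<open>n\<close> is at
      most \<open>2 * n * L\<close>, which completes the power \<open>2 * p + 1\<close>.\<close>
    also have "real n * (real n * L) powr (2 * p) \<le> (2 * real n * L) * (2 * real n * L) powr (2 * p)"
      using n0 L p by (intro mult_mono powr_mono2) auto
    also have "\<dots> = (2 * real n * L) powr (2 * p + 1)"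
      using n0 L by (simp add: powr_add)
    finally have "S \<le> ((2 * real n * L) powr (2 * p + 1)) powr (1 / (2 * p + 1))"
      unfolding S_def using p n0 M by (intro powr_mono2) auto
    also have "\<dots> = 2 * real n * L"
      using p' n0 L by (simp add: powr_powr)
    finally show ?thesis .
  qed

  \<comment> \<open>6400 / 32 = 200 is the least value of \<open>R\<close> that the general bound
    admits.\<close>
  define R where "R = 6400 * S"
  have R: "200 \<le> R"
    using S1 by (simp add: R_def)
  define N where "N = nat \<lfloor>R / 101\<rfloor>"
  have N: "101 * real N \<le> R" "R \<le> 101 * (real N + 1)" "1 \<le> N"
  proof -
    have fl: "1 \<le> \<lfloor>R / 101\<rfloor>"
      using R by (simp add: le_floor_iff)
    then have N': "real N = of_int \<lfloor>R / 101\<rfloor>"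
      by (simp add: N_def)
    show "101 * real N \<le> R" "R \<le> 101 * (real N + 1)"
      unfolding N' using real_of_int_floor_add_one_ge[of "R / 101"] of_int_floor_le[of "R / 101"]
      by (simp_all add: field_simps)
    show "1 \<le> N"
      using nat_mono[OF fl] by (simp only: N_def nat_1 One_nat_def)
  qed
  define D where "D = S / real n * L powr (- 11)"
  have K: "1 \<le> K"
    using p by (simp add: K_def ge_one_powr_ge_zero)
  have Linv: "L powr (- 11) = (1 / L) ^ 11" "1 / L \<le> 2"
    using L by (simp_all add: powr_minus powr_numeral field_simps)
  have D0: "0 \<le> D"
    using S0 n0 by (simp add: D_def)
  have D1: "D \<le> 2 ^ 11 * (S / real n)"
  proof -
    have "L powr (- 11) \<le> 2 ^ 11"
      unfolding Linv using Linv L by (intro power_mono) auto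
    then show ?thesis
      unfolding D_def using S0 n0 by (subst mult.commute) (intro mult_right_mono, auto)
  qed
  \<comment> \<open>One of the eleven logarithms cancels that in \<open>S \<le> 2 * n * L\<close>;
    the other ten cost at most \<open>2 ^ 10\<close>, as \<open>1 / L \<le> 2\<close>.\<close>
  have D2: "D \<le> 2 ^ 11"
  proof -
    have "D \<le> (2 * L) * (1 / L) ^ 11"
      unfolding D_def Linv using S2 n0 L by (intro mult_right_mono) (auto simp: field_simps)
    also have "\<dots> = 2 * (1 / L) ^ 10"
      using L by (simp add: field_simps eval_nat_numeral)
    also have "\<dots> \<le> 2 * 2 ^ 10"
      using Linv L by (intro mult_left_mono power_mono) auto
    finally show ?thesis by simp
  qed
  \<comment> \<open>The total mass \<open>N w\<close> of the nonzero locations is set to the target rate divided by \<open>S\<^sup>2\<close>.\<close>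
  define w where "w = 1 / (2 ^ 11 * K) * D / real N"
  have Nw: "real N * w = 1 / (2 ^ 11 * K) * D"
    using N by (simp add: w_def)
  have KD: "1 / (2 ^ 11 * K) * D \<le> u" if "D \<le> 2 ^ 11 * u" for u
  proof -
    have "D \<le> 2 ^ 11 * u * 1" using that by simp
    also have "\<dots> \<le> 2 ^ 11 * u * K"
      using that D0 K by (intro mult_left_mono) auto
    finally show ?thesis
      using K by (simp add: field_simps)
  qed
  have "ereal (real N * w * R\<^sup>2 / 16) \<le> regret n (moment_class p M)"
  proof (rule regret_moment_class_ge)
    show "0 \<le> w"
      using D0 K by (simp add: w_def)
    show "real N * w \<le> 1"
      unfolding Nw using D2 by (intro KD) simp
    \<comment> \<open>\<open>6400 * S = R \<le> 101 * (N + 1) \<le> 202 * N\<close>, hence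
      \<open>2 * S \<le> N\<close>.\<close>
    have "S / real n \<le> real N / (2 * real n)"
      using N R n0 by (simp add: R_def field_simps)
    moreover have "real N * w \<le> S / real n"
      unfolding Nw using D1 by (rule KD)
    ultimately have "real N * w \<le> real N / (2 * real n)"
      by linarith
    then show "2 * real n * w \<le> 1"
      using N n0 by (simp add: field_simps)
    \<comment> \<open>\<open>K\<close> collects the constants of the moment and cancels against the
      factor \<open>1 / K\<close> in the mass.\<close>
    have "(4 * R\<^sup>2) powr p = K * S powr (2 * p)"
      using S0 by (simp add: K_def R_def powr_mult power_mult_distrib powr_powr flip: powr_numeral)
    then have "real N * w * (4 * R\<^sup>2) powr p = D / 2 ^ 11 * S powr (2 * p)"
      unfolding Nw using K by simp
    also have "\<dots> \<le> S / real n * S powr (2 * p)"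
      using D1 by (intro mult_right_mono) (simp_all add: divide_le_eq mult.commute)
    also have "\<dots> = S powr (2 * p + 1) / real n"
      using S0 by (simp add: powr_add)
    also have "\<dots> = M"
      using Spow n0 by simp
    finally show "real N * w * (4 * R\<^sup>2) powr p \<le> M" .
  qed (use p n R N in auto)
  moreover have "1 / (2 ^ 11 * K) * real n powr (- 2 * (p - 1) / (2 * p + 1)) * M powr (3 / (2 * p + 1)) * L powr (- 11)
      \<le> real N * w * R\<^sup>2 / 16"
  proof -
    have "S ^ 3 = (real n * M) powr (3 / (2 * p + 1))"
      using S0 by (simp add: S_def powr_powr flip: powr_numeral)
    \<comment> \<open>The exponents agree:
      \<open>3 / (2 * p + 1) = 1 - 2 * (p - 1) / (2 * p + 1)\<close>.\<close>
    also have "\<dots> = real n powr (- 2 * (p - 1) / (2 * p + 1) + 1) * M powr (3 / (2 * p + 1))"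
      using n0 M p' by (simp add: powr_mult field_simps)
    also have "\<dots> = real n * (real n powr (- 2 * (p - 1) / (2 * p + 1)) * M powr (3 / (2 * p + 1)))"
      using n0 by (simp add: powr_add)
    finally have "real n powr (- 2 * (p - 1) / (2 * p + 1)) * M powr (3 / (2 * p + 1)) = S ^ 3 / real n"
      using n0 by simp
    then have "1 / (2 ^ 11 * K) * real n powr (- 2 * (p - 1) / (2 * p + 1)) * M powr (3 / (2 * p + 1)) * L powr (- 11)
        = 1 / (2 ^ 11 * K) * (S ^ 3 / real n) * L powr (- 11)"
      by (simp only: mult.assoc)
    also have "\<dots> = real N * w * S\<^sup>2"
      unfolding Nw D_def by (simp add: eval_nat_numeral)
    also have "\<dots> \<le> real N * w * (R\<^sup>2 / 16)"
      unfolding Nw using D0 K S0 by (intro mult_left_mono) (auto simp: R_def power_mult_distrib)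
    finally show ?thesis by simp
  qed
  ultimately show ?thesis
    unfolding L_def by (meson ereal_less_eq(3) order_trans)
qed

theorem theorem3:
  fixes p :: real
  assumes "p \<ge> 1"
  shows "\<exists>c::real. c > 0 \<and> (\<forall>n::nat. n \<ge> 2 \<longrightarrow>
    (p > 1 \<longrightarrow> (\<forall>M::real. M > 0 \<longrightarrow>
        real n powr (- 1 / p) * ln (real n) ^ 10 \<le> M powr (1 / p) \<longrightarrow>
        M powr (1 / p) \<le> real n ^ 2 * ln (real n) ^ 2 \<longrightarrow>
        regret n (moment_class p M) \<ge>
          ereal (c * real n powr (- 2 * (p - 1) / (2 * p + 1)) * M powr (3 / (2 * p + 1))
                 * ln (real n) powr (- 11)))) \<and>
    (p = 1 \<longrightarrow> (\<forall>M::real. M > 0 \<longrightarrow> regret n (moment_class 1 M) \<ge> ereal (c * M))))"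
proof (cases "p = 1")
  case True
  show ?thesis
  proof (rule exI[of _ "1 / 64"], intro conjI allI impI)
    fix n :: nat and M :: real
    assume "n \<ge> 2" "M > 0"
    then show "regret n (moment_class 1 M) \<ge> ereal (1 / 64 * M)"
      using regret_moment_class_one_ge[of n M] by simp
  qed (use True in auto)
next
  case False
  show ?thesis
  proof (rule exI[of _ "1 / (2 ^ 11 * (4 * 6400\<^sup>2) powr p)"], intro conjI allI impI)
    fix n :: nat and M :: real
    assume "n \<ge> 2" "M > 0" "real n powr (- 1 / p) * ln (real n) ^ 10 \<le> M powr (1 / p)"
      "M powr (1 / p) \<le> real n ^ 2 * ln (real n) ^ 2"
    then show "regret n (moment_class p M) \<ge>
        ereal (1 / (2 ^ 11 * (4 * 6400\<^sup>2) powr p) * real n powr (- 2 * (p - 1) / (2 * p + 1))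
          * M powr (3 / (2 * p + 1)) * ln (real n) powr (- 11))"
      by (rule regret_moment_class_ge_rate[OF assms])
  qed (use False in auto)
qed

end
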